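(* For every integer $k\ge 2$ there exists a $k$-$\chi_\rho$-critical tree.
   Context: Graphs (in particular trees) are finite, simple and undirected, with nonempty vertex set. Distance is shortest-path distance ($\infty$ between different components). For a positive integer $i$, an $i$-packing in $G$ is a set of vertices such that any two distinct vertices in it are at distance greater than $i$. The packing chromatic number $\chi_\rho(G)$ is the smallest integer $k$ such that $V(G)$ can be partitioned into (possibly empty) sets $V_1,\ldots,V_k$ with $V_i$ an $i$-packing for each $i\in\{1,\ldots,k\}$. $G-x$ denotes the graph obtained from $G$ by deleting the vertex $x$. A graph $G$ is $k$-$\chi_\rho$-critical if $\chi_\rho(G)=k$ and $\chi_\rho(G-x)<k$ for every vertex $x$ of $G$. *)

theory Defs
  imports "Graph_Theory.Graph_Theory" "HOL-Library.Disjoint_Sets"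
begin

text \<open>
  Finite simple undirected graphs are symmetric loop-free finite digraphs without parallel arcs
  (locales \<^locale>\<open>graph\<close> and \<^locale>\<open>pair_graph\<close>), each edge being a pair of opposite arcs.
  Such a pair of arcs is a directed cycle of length 2, so \<^const>\<open>forest\<close> and \<^const>\<open>tree\<close>
  are not the undirected notions. In a graph in the above sense, the undirected cycles are
  exactly the directed cycles of length at least 3. Nonemptiness of the vertex set is part of
  \<^const>\<open>connected\<close>.
\<close>

definition undirected_tree :: "('a, 'b) pre_digraph \<Rightarrow> bool" where
  "undirected_tree G \<longleftrightarrow>
     graph G \<and> connected G \<and> \<not> (\<exists>p. pre_digraph.cycle G p \<and> 3 \<le> length p)"

text \<open>
  With unit weights, \<^const>\<open>wf_digraph.\<mu>\<close> is the least number of arcs of a walk from \<open>u\<close> to \<open>v\<close>,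
  and \<open>\<infinity>\<close> if there is no such walk.
\<close>

definition graph_dist :: "('a, 'b) pre_digraph \<Rightarrow> 'a \<Rightarrow> 'a \<Rightarrow> ereal" where
  "graph_dist G u v = wf_digraph.\<mu> G (\<lambda>_. 1) u v"

definition is_packing :: "('a, 'b) pre_digraph \<Rightarrow> nat \<Rightarrow> 'a set \<Rightarrow> bool" where
  "is_packing G i S \<longleftrightarrow>
     S \<subseteq> verts G \<and> (\<forall>u\<in>S. \<forall>v\<in>S. u \<noteq> v \<longrightarrow> ereal (real i) < graph_dist G u v)"

definition packing_colorable :: "('a, 'b) pre_digraph \<Rightarrow> nat \<Rightarrow> bool" where
  "packing_colorable G k \<longleftrightarrow>
     (\<exists>V :: nat \<Rightarrow> 'a set.
        (\<Union>i\<in>{1..k}. V i) = verts G \<and>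
        disjoint_family_on V {1..k} \<and>
        (\<forall>i\<in>{1..k}. is_packing G i (V i)))"

text \<open>
  A finite graph with \<open>n\<close> vertices is packing colorable with \<open>n\<close> colors (all classes being
  singletons), so the minimum exists. The graph without vertices gets the value \<open>0\<close>.
\<close>

definition packing_chromatic_number :: "('a, 'b) pre_digraph \<Rightarrow> nat" where
  "packing_chromatic_number G = (LEAST k. packing_colorable G k)"

definition packing_critical :: "nat \<Rightarrow> ('a, 'b) pre_digraph \<Rightarrow> bool" where
  "packing_critical k G \<longleftrightarrow>
     packing_chromatic_number G = k \<and>
     (\<forall>x\<in>verts G. packing_chromatic_number (pre_digraph.del_vert G x) < k)"

end

theory Submission
  imports Defs
begin

text \<open>
  Call a forest heap-ordered if its vertices are linearly ordered so that every vertex has at most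
  one smaller neighbor. The largest vertex of such a forest has at most one neighbor, so it is
  isolated or a leaf, and induced subgraphs are again heap-ordered. There is no cycle of length at
  least 3, since its largest vertex would have two smaller neighbors.

  Write \<open>k = q + 1\<close>. A \<open>q\<close>-ary tree of depth two, numbered level by level, is heap-ordered and
  has no packing coloring with \<open>q\<close> colors: whenever a vertex has at least \<open>q\<close> neighbors,
  one of these must get color 1, because they are pairwise at distance at most 2 and would otherwise
  need \<open>q\<close> distinct colors from \<open>{2..q}\<close>; hence the vertex itself does not get color 1.
  Applied to the root this yields a child of color 1, and applied to that child it yields a
  contradiction.

  Now take a finite set \<open>S\<close> of vertices of the infinite \<open>q\<close>-ary tree, of least cardinality among
  those inducing a subgraph that is not packing colorable with \<open>q\<close> colors. By minimality every
  deletion of a vertex leaves a subgraph that is colorable with \<open>q\<close> colors. The graph on \<open>S\<close> is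
  connected, since otherwise colorings of one component and of the rest could be put together, the
  distances between the two parts being infinite. It is
  colorable with \<open>q + 1\<close> colors: deleting the largest vertex does not change the distances between
  the other vertices, so a coloring with \<open>q\<close> colors of the rest extends by a new color. So
  \<open>S\<close> induces a critical tree.
\<close>

section \<open>Induced subgraphs of a relation and their packing colorings\<close>

definition induced :: "'a rel \<Rightarrow> 'a set \<Rightarrow> 'a pair_pre_digraph" where
  "induced E S = \<lparr>pverts = S, parcs = Restr E S\<rparr>"

text \<open>
  A color function in place of a family of packings, with distances expressed by the powers of
  the adjacency relation: distance greater than \<open>i\<close> means that every walk has more than \<open>i\<close> steps.
  Deleting and adding vertices then only needs inductions on the length of walks.
\<close>

definition packing_coloring :: "'a rel \<Rightarrow> 'a set \<Rightarrow> nat \<Rightarrow> ('a \<Rightarrow> nat) \<Rightarrow> bool" where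
  "packing_coloring E S k c \<longleftrightarrow>
     (\<forall>v\<in>S. c v \<in> {1..k}) \<and>
     (\<forall>u\<in>S. \<forall>v\<in>S. \<forall>n. u \<noteq> v \<longrightarrow> c u = c v \<longrightarrow> (u, v) \<in> Restr E S ^^ n \<longrightarrow> c u < n)"

lemma packing_coloring_range: "packing_coloring E S k c \<Longrightarrow> v \<in> S \<Longrightarrow> c v \<in> {1..k}"
  unfolding packing_coloring_def by blast

lemma packing_coloring_dist:
  "packing_coloring E S k c \<Longrightarrow> u \<in> S \<Longrightarrow> v \<in> S \<Longrightarrow> u \<noteq> v \<Longrightarrow> c u = c v
     \<Longrightarrow> (u, v) \<in> Restr E S ^^ n \<Longrightarrow> c u < n"
  unfolding packing_coloring_def by blast

lemma induced_simps [simp]: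
  "pverts (induced E S) = S" "parcs (induced E S) = Restr E S"
  by (simp_all add: induced_def)

lemma wf_induced: "wf_digraph (with_proj (induced E S))"
  by unfold_locales auto

lemma awalk_induced_iff_relpow:
  "(\<exists>p. pre_digraph.awalk (with_proj (induced E S)) u p v \<and> length p = n)
     \<longleftrightarrow> u \<in> S \<and> (u, v) \<in> Restr E S ^^ n"
proof (induction n arbitrary: u)
  case 0
  interpret wf_digraph "with_proj (induced E S)" by (rule wf_induced)
  show ?case by (auto simp: awalk_Nil_iff)
next
  case (Suc n)
  interpret wf_digraph "with_proj (induced E S)" by (rule wf_induced)
  have "(\<exists>p. awalk u p v \<and> length p = Suc n) \<longleftrightarrow>
        (\<exists>w. (u, w) \<in> Restr E S \<and> (\<exists>p. awalk w p v \<and> length p = n))"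
  proof
    assume "\<exists>p. awalk u p v \<and> length p = Suc n"
    then obtain e p where "awalk u (e # p) v" "length p = n"
      by (auto simp: length_Suc_conv)
    then have "(u, snd e) \<in> Restr E S \<and> awalk (snd e) p v \<and> length p = n"
      by (cases e) (auto simp: awalk_Cons_iff)
    then show "\<exists>w. (u, w) \<in> Restr E S \<and> (\<exists>p. awalk w p v \<and> length p = n)" by blast
  next
    assume "\<exists>w. (u, w) \<in> Restr E S \<and> (\<exists>p. awalk w p v \<and> length p = n)"
    then obtain w p where "(u, w) \<in> Restr E S" "awalk w p v" "length p = n" by blast
    then have "awalk u ((u, w) # p) v \<and> length ((u, w) # p) = Suc n"
      by (simp add: awalk_Cons_iff)
    then show "\<exists>p. awalk u p v \<and> length p = Suc n" by blast
  qed
  also have "\<dots> \<longleftrightarrow> u \<in> S \<and> (u, v) \<in> Restr E S ^^ Suc n"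
    unfolding Suc.IH relpow.simps(2) relpow_commute[symmetric] by blast
  finally show ?case .
qed

lemma less_graph_dist_induced_iff:
  assumes "u \<in> S"
  shows "ereal (real i) < graph_dist (with_proj (induced E S)) u v
           \<longleftrightarrow> (\<forall>n. (u, v) \<in> Restr E S ^^ n \<longrightarrow> i < n)"
proof -
  interpret wf_digraph "with_proj (induced E S)" by (rule wf_induced)
  have cost: "awalk_cost (\<lambda>_. 1) p = real (length p)" for p :: "('a \<times> 'a) list"
    by (induction p) simp_all
  have dist: "graph_dist (with_proj (induced E S)) u v
      = (INF p\<in>{p. awalk u p v}. ereal (real (length p)))"
    unfolding graph_dist_def \<mu>_def cost ..
  show ?thesis
  proof
    assume less: "ereal (real i) < graph_dist (with_proj (induced E S)) u v"
    show "\<forall>n. (u, v) \<in> Restr E S ^^ n \<longrightarrow> i < n"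
    proof (intro allI impI)
      fix n assume "(u, v) \<in> Restr E S ^^ n"
      then obtain p where "awalk u p v" "length p = n"
        using awalk_induced_iff_relpow[of E S u v n] assms by auto
      then have "graph_dist (with_proj (induced E S)) u v \<le> ereal (real n)"
        unfolding dist by (auto intro: INF_lower2)
      with less have "ereal (real i) < ereal (real n)" by (rule less_le_trans)
      then show "i < n" by simp
    qed
  next
    assume far: "\<forall>n. (u, v) \<in> Restr E S ^^ n \<longrightarrow> i < n"
    have "ereal (real (Suc i)) \<le> graph_dist (with_proj (induced E S)) u v"
      unfolding dist
    proof (rule INF_greatest)
      fix p assume "p \<in> {p. awalk u p v}"
      then have "(u, v) \<in> Restr E S ^^ length p"
        using awalk_induced_iff_relpow[of E S u v "length p"] by auto
      with far have "i < length p" by blast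
      then show "ereal (real (Suc i)) \<le> ereal (real (length p))" by simp
    qed
    moreover have "ereal (real i) < ereal (real (Suc i))" by simp
    ultimately show "ereal (real i) < graph_dist (with_proj (induced E S)) u v"
      by (rule less_le_trans[rotated])
  qed
qed

lemma packing_colorable_induced_iff:
  "packing_colorable (with_proj (induced E S)) k \<longleftrightarrow> (\<exists>c. packing_coloring E S k c)"
proof
  assume "packing_colorable (with_proj (induced E S)) k"
  then obtain V where V: "(\<Union>i\<in>{1..k}. V i) = S" "disjoint_family_on V {1..k}"
    and pack: "\<forall>i\<in>{1..k}. is_packing (with_proj (induced E S)) i (V i)"
    unfolding packing_colorable_def by auto
  have "\<forall>v\<in>S. \<exists>i\<in>{1..k}. v \<in> V i" using V(1) by blast
  then obtain c where c: "\<And>v. v \<in> S \<Longrightarrow> c v \<in> {1..k} \<and> v \<in> V (c v)"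
    by metis
  have "c u < n" if "u \<in> S" "v \<in> S" "u \<noteq> v" "c u = c v" "(u, v) \<in> Restr E S ^^ n" for u v n
  proof -
    have "is_packing (with_proj (induced E S)) (c u) (V (c u))" "u \<in> V (c u)" "v \<in> V (c u)"
      using c[of u] c[of v] that(1,2,4) pack by fastforce+
    then have "ereal (real (c u)) < graph_dist (with_proj (induced E S)) u v"
      using \<open>u \<noteq> v\<close> unfolding is_packing_def by blast
    then show ?thesis
      using that less_graph_dist_induced_iff[of u S "c u" E v] by blast
  qed
  then have "packing_coloring E S k c"
    unfolding packing_coloring_def using c by blast
  then show "\<exists>c. packing_coloring E S k c" by blast
next
  assume "\<exists>c. packing_coloring E S k c"
  then obtain c where c: "packing_coloring E S k c" ..
  let ?V = "\<lambda>i. {v \<in> S. c v = i}"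
  have "(\<Union>i\<in>{1..k}. ?V i) = S"
    using packing_coloring_range[OF c] by auto
  moreover have "disjoint_family_on ?V {1..k}"
    by (auto simp: disjoint_family_on_def)
  moreover have "is_packing (with_proj (induced E S)) i (?V i)" for i
    unfolding is_packing_def
    by (auto simp: less_graph_dist_induced_iff) (metis packing_coloring_dist[OF c])
  ultimately show "packing_colorable (with_proj (induced E S)) k"
    unfolding packing_colorable_def by (intro exI[of _ ?V]) auto
qed

lemma packing_coloring_mono: "packing_coloring E S j c \<Longrightarrow> j \<le> k \<Longrightarrow> packing_coloring E S k c"
  unfolding packing_coloring_def by fastforce

lemma del_vert_induced:
  "pre_digraph.del_vert (with_proj (induced E S)) x = with_proj (induced E (S - {x}))"
  by (auto simp: pre_digraph.del_vert_def with_proj_def induced_def)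

section \<open>Extending and gluing packing colorings\<close>

text \<open>
  Deleting a leaf or an isolated vertex does not increase the distances between the remaining
  vertices. This is the step where deleting a vertex of larger degree would fail.
\<close>

lemma relpow_Restr_avoiding_leaf:
  assumes leaf: "\<And>a b. (a, m) \<in> E \<Longrightarrow> (m, b) \<in> E \<Longrightarrow> a \<in> S \<Longrightarrow> b \<in> S \<Longrightarrow> a = b"
    and "(m, m) \<notin> E"
  shows "(u, v) \<in> Restr E S ^^ n \<Longrightarrow> u \<noteq> m \<Longrightarrow> v \<noteq> m
           \<Longrightarrow> \<exists>j\<le>n. (u, v) \<in> Restr E (S - {m}) ^^ j"
proof (induction n arbitrary: u rule: less_induct)
  case (less n)
  show ?case
  proof (cases n)
    case 0
    with less.prems show ?thesis by auto
  next
    case (Suc n')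
    obtain w where w: "(u, w) \<in> Restr E S" "(w, v) \<in> Restr E S ^^ n'"
      using less.prems(1) unfolding Suc by (rule relpow_Suc_E2)
    show ?thesis
    proof (cases "w = m")
      case False
      then obtain j where "j \<le> n'" "(w, v) \<in> Restr E (S - {m}) ^^ j"
        using less.IH[of n' w] w(2) less.prems Suc by auto
      moreover have "(u, w) \<in> Restr E (S - {m})"
        using w(1) False less.prems by auto
      ultimately show ?thesis
        using Suc relpow_Suc_I2 by (metis Suc_le_mono)
    next
      case True
      \<comment> \<open>A walk that enters the leaf must return to the vertex it came from, so the detour
        can be cut out.\<close>
      with w(2) less.prems(3) obtain n'' where n'': "n' = Suc n''"
        by (cases n') auto
      obtain w' where "(m, w') \<in> Restr E S" "(w', v) \<in> Restr E S ^^ n''"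
        using w(2) unfolding True n'' by (rule relpow_Suc_E2)
      moreover from this(1) have "w' = u"
        using leaf[of u w'] w(1) True by auto
      ultimately obtain j where "j \<le> n''" "(u, v) \<in> Restr E (S - {m}) ^^ j"
        using less.IH[of n'' u] less.prems Suc n'' by auto
      then show ?thesis
        using Suc n'' by (intro exI[of _ j]) auto
    qed
  qed
qed

lemma packing_coloring_add_leaf:
  assumes leaf: "\<And>a b. (a, m) \<in> E \<Longrightarrow> (m, b) \<in> E \<Longrightarrow> a \<in> S \<Longrightarrow> b \<in> S \<Longrightarrow> a = b"
    and "(m, m) \<notin> E"
    and c: "packing_coloring E (S - {m}) k c"
  shows "packing_coloring E S (Suc k) (c(m := Suc k))"
proof -
  have range: "c v \<in> {1..k}" if "v \<in> S" "v \<noteq> m" for v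
    using packing_coloring_range[OF c] that by blast
  have "c u < n" if "u \<in> S" "v \<in> S" "u \<noteq> v" "u \<noteq> m" "v \<noteq> m" "c u = c v"
    "(u, v) \<in> Restr E S ^^ n" for u v n
  proof -
    from relpow_Restr_avoiding_leaf[OF leaf \<open>(m, m) \<notin> E\<close> that(7,4,5)]
    obtain j where "j \<le> n" "(u, v) \<in> Restr E (S - {m}) ^^ j" by blast
    with packing_coloring_dist[OF c, of u v j] that show ?thesis by auto
  qed
  moreover have "c v \<noteq> Suc k" if "v \<in> S" "v \<noteq> m" for v
    using range[OF that] by simp
  ultimately show ?thesis
    unfolding packing_coloring_def using range by (auto split: if_splits; force)
qed

lemma relpow_Restr_closed:
  assumes closed: "\<And>a b. (a, b) \<in> Restr E S \<Longrightarrow> a \<in> C \<Longrightarrow> b \<in> C"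
  shows "(u, v) \<in> Restr E S ^^ n \<Longrightarrow> u \<in> C \<Longrightarrow> v \<in> C \<and> (u, v) \<in> Restr E C ^^ n"
proof (induction n arbitrary: v)
  case 0
  then show ?case by simp
next
  case (Suc n)
  then obtain w where "(u, w) \<in> Restr E S ^^ n" "(w, v) \<in> Restr E S" by auto
  with Suc show ?case using closed[of w v] by auto
qed

text \<open>
  The hypothesis on \<open>C\<close> says that no edge leaves \<open>C\<close>, so a walk stays on the side on which it starts:
  distances within each side are those of its induced subgraph, and a color may be used
  on both sides.
\<close>

lemma packing_coloring_glue:
  assumes "\<And>a b. (a, b) \<in> Restr E S \<Longrightarrow> a \<in> C \<longleftrightarrow> b \<in> C" and "C \<subseteq> S"
    and c: "packing_coloring E C k c" and d: "packing_coloring E (S - C) k d"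
  shows "packing_coloring E S k (\<lambda>v. if v \<in> C then c v else d v)"
proof -
  have in_C: "v \<in> C \<and> (u, v) \<in> Restr E C ^^ n"
    if "(u, v) \<in> Restr E S ^^ n" "u \<in> C" for u v n
    using relpow_Restr_closed[of E S C u v n] assms(1) that by blast
  have out_C: "v \<in> S - C \<and> (u, v) \<in> Restr E (S - C) ^^ n"
    if "(u, v) \<in> Restr E S ^^ n" "u \<in> S - C" for u v n
    using relpow_Restr_closed[of E S "S - C" u v n] assms(1) that by blast
  show ?thesis
    unfolding packing_coloring_def
  proof (intro conjI ballI allI impI)
    fix v assume "v \<in> S"
    then show "(if v \<in> C then c v else d v) \<in> {1..k}"
      using packing_coloring_range[OF c] packing_coloring_range[OF d] by auto
  next
    fix u v n
    assume "u \<in> S" "v \<in> S" "u \<noteq> v" "(u, v) \<in> Restr E S ^^ n"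
      and eq: "(if u \<in> C then c u else d u) = (if v \<in> C then c v else d v)"
    then show "(if u \<in> C then c u else d u) < n"
      using in_C[of u v n] out_C[of u v n]
        packing_coloring_dist[OF c, of u v n] packing_coloring_dist[OF d, of u v n]
      by (cases "u \<in> C") auto
  qed
qed

section \<open>Heap-ordered forests\<close>

text \<open>
  Acyclicity is replaced by a local condition that passes to induced subgraphs and that
  provides a leaf at once. The smaller neighbor of a vertex is its parent.
\<close>

locale heap_ordered_forest =
  fixes E :: "'a::linorder rel"
  assumes sym: "sym E" and irrefl: "irrefl E"
    and smaller_neighbor_unique:
      "(u, v) \<in> E \<Longrightarrow> (w, v) \<in> E \<Longrightarrow> u < v \<Longrightarrow> w < v \<Longrightarrow> u = w"
begin

lemma graph_induced:
  assumes "finite S"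
  shows "graph (with_proj (induced E S))"
proof -
  have "pair_graph (induced E S)"
    using assms sym irrefl
    by unfold_locales (auto simp: symmetric_def sym_def irrefl_def)
  then show ?thesis by (rule pair_graph.pair_graphD_graph)
qed

lemma Max_is_leaf:
  assumes "finite S" "(a, Max S) \<in> E" "(Max S, b) \<in> E" "a \<in> S" "b \<in> S"
  shows "a = b"
proof -
  have "(b, Max S) \<in> E" using assms(3) sym by (auto dest: symD)
  moreover have "a \<noteq> Max S" "b \<noteq> Max S"
    using assms irrefl by (auto simp: irrefl_def)
  then have "a < Max S" "b < Max S"
    using assms by (auto simp: order.strict_iff_order)
  ultimately show ?thesis
    using smaller_neighbor_unique assms(2) by blast
qed

text \<open>
  The largest vertex of a cycle has a predecessor and a successor on it, which must coincide by
  \<open>Max_is_leaf\<close>, applied to the vertex set of the cycle. On a cycle of length at least 3 they are distinct.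
\<close>

lemma no_long_cycle:
  assumes "pre_digraph.cycle (with_proj (induced E S)) p"
  shows "length p < 3"
proof (rule ccontr)
  assume "\<not> length p < 3"
  interpret pair_wf_digraph "induced E S" using wf_induced wf_digraph_wp_iff by metis
  from assms obtain u where u: "awalk u p u" "distinct (tl (awalk_verts u p))" "p \<noteq> []"
    unfolding cycle_def by auto
  have cas: "pcas u p u" using u(1) by (auto simp: awalk_def)
  have arcs: "set p \<subseteq> Restr E S" using u(1) by (auto simp: awalk_def)
  have dist: "distinct (map snd p)"
    using u(2,3) cas awalk_verts_conv'[of u p u] by simp
  have tails: "pcas a q b \<Longrightarrow> i < length q \<Longrightarrow> fst (q ! i) = (if i = 0 then a else snd (q ! (i - 1)))"
    for a b i and q :: "('a \<times> 'a) list"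
    by (induction q arbitrary: a i) (auto simp: nth_Cons split: nat.splits)
  have "pcas a q b \<Longrightarrow> q \<noteq> [] \<Longrightarrow> snd (last q) = b"
    for a b and q :: "('a \<times> 'a) list"
    by (induction q arbitrary: a) (auto split: if_splits)
  then have last: "snd (p ! (length p - 1)) = u"
    using cas u(3) by (simp add: last_conv_nth)
  define n where "n = length p"
  have n: "3 \<le> n" using \<open>\<not> length p < 3\<close> by (simp add: n_def)
  define m where "m = Max (set (map snd p))"
  have "m \<in> set (map snd p)" unfolding m_def using u(3) by (intro Max_in) auto
  then obtain i where i: "i < n" "snd (p ! i) = m"
    by (auto simp: in_set_conv_nth n_def)
  \<comment> \<open>The vertex at a position is the head of the arc there; \<open>j\<close> and \<open>l\<close> are the positions
    cyclically before and after that of the largest vertex.\<close>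
  define j where "j = (if i = 0 then n - 1 else i - 1)"
  define l where "l = (if Suc i = n then 0 else Suc i)"
  have jl: "j < n" "l < n" "j \<noteq> l" using i(1) n by (auto simp: j_def l_def)
  have "fst (p ! i) = snd (p ! j)"
    using tails[OF cas, of i] last i(1) by (auto simp: j_def n_def)
  moreover have "p ! i \<in> E" using arcs i(1) nth_mem[of i p] by (auto simp: n_def)
  ultimately have E1: "(snd (p ! j), m) \<in> E" using i(2) by (metis prod.collapse)
  have "fst (p ! l) = m"
  proof (cases "Suc i = n")
    case True
    then have "i = length p - 1" "l = 0" by (simp_all add: n_def l_def)
    then show ?thesis
      using tails[OF cas, of 0] last i(2) u(3) by simp
  next
    case False
    then show ?thesis
      using tails[OF cas, of l] i jl(2) by (simp add: l_def n_def)
  qed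
  moreover have "p ! l \<in> E" using arcs jl(2) nth_mem[of l p] by (auto simp: n_def)
  ultimately have "(m, snd (p ! l)) \<in> E" by (metis prod.collapse)
  moreover have "snd (p ! j) \<in> set (map snd p)" "snd (p ! l) \<in> set (map snd p)"
    using jl by (auto simp: n_def)
  ultimately have "snd (p ! j) = snd (p ! l)"
    using E1 Max_is_leaf[of "set (map snd p)"] unfolding m_def by blast
  then show False
    using dist jl by (simp add: distinct_conv_nth n_def)
qed

end

text \<open>
  The indecomposability hypothesis is applied to the set of vertices reachable from a given one.
\<close>

lemma connected_if_no_proper_component:
  assumes "sym E" "S \<noteq> {}"
    and indecomposable: "\<And>C. C \<subseteq> S \<Longrightarrow> C \<noteq> {}
        \<Longrightarrow> (\<And>a b. (a, b) \<in> Restr E S \<Longrightarrow> a \<in> C \<longleftrightarrow> b \<in> C) \<Longrightarrow> C = S"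
  shows "connected (with_proj (induced E S))"
proof -
  have "mk_symmetric (with_proj (induced E S)) = induced E S"
    using \<open>sym E\<close> by (auto simp: mk_symmetric_def induced_def dest: symD)
  moreover have "(u, v) \<in> rtrancl_on S (Restr E S)" if "u \<in> S" "v \<in> S" for u v
  proof -
    let ?C = "{w. (u, w) \<in> rtrancl_on S (Restr E S)}"
    have "?C = S"
    proof (rule indecomposable)
      show "?C \<subseteq> S" by (auto dest: in_rtrancl_on_in_F)
      show "?C \<noteq> {}" using that by auto
      fix a b assume "(a, b) \<in> Restr E S"
      then have "(a, b) \<in> Restr E S" "(b, a) \<in> Restr E S" "a \<in> S" "b \<in> S"
        using \<open>sym E\<close> by (auto dest: symD)
      then show "a \<in> ?C \<longleftrightarrow> b \<in> ?C"
        by (auto intro: rtrancl_on_into_rtrancl_on)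
    qed
    with that show ?thesis by auto
  qed
  ultimately show ?thesis
    using \<open>S \<noteq> {}\<close> unfolding connected_def strongly_connected_def reachable_def by auto
qed

section \<open>A tree of depth two that needs many colors\<close>

text \<open>
  Two neighbors of \<open>x\<close> are joined by a walk of length 2, so they share no color except possibly 1.
  If color 1 is absent from \<open>A\<close>, then \<open>q\<close> elements of \<open>A\<close> have different colors among
  only \<open>q - 1\<close>.
\<close>

lemma neighbor_with_color_1:
  assumes c: "packing_coloring E S q c" and "sym E" and "1 \<le> q"
    and "x \<in> S" "A \<subseteq> S" "x \<notin> A" and adj: "\<And>a. a \<in> A \<Longrightarrow> (x, a) \<in> E" and card: "q \<le> card A"
  obtains a where "a \<in> A" "c a = 1" "c x \<noteq> 1"
proof -
  have "\<exists>a\<in>A. c a = 1"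
  proof (rule ccontr)
    assume no: "\<not> (\<exists>a\<in>A. c a = 1)"
    have range: "c a \<in> {2..q}" if "a \<in> A" for a
    proof -
      have "c a \<in> {1..q}" "c a \<noteq> 1"
        using packing_coloring_range[OF c] that \<open>A \<subseteq> S\<close> no by blast+
      then show ?thesis by auto
    qed
    have "inj_on c A"
    proof (rule inj_onI, rule ccontr)
      fix a b assume ab: "a \<in> A" "b \<in> A" "c a = c b" "a \<noteq> b"
      have "(a, x) \<in> Restr E S" "(x, b) \<in> Restr E S"
        using ab adj \<open>sym E\<close> \<open>x \<in> S\<close> \<open>A \<subseteq> S\<close> by (auto dest: symD)
      then have "(a, b) \<in> Restr E S ^^ 2" by (auto simp: numeral_2_eq_2)
      then have "c a < 2"
        using packing_coloring_dist[OF c, of a b 2] ab \<open>A \<subseteq> S\<close> by auto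
      with range[OF ab(1)] show False by simp
    qed
    then have "card A \<le> card {2..q}"
      using range by (intro card_inj_on_le[of c]) auto
    with card \<open>1 \<le> q\<close> show False by simp
  qed
  then obtain a where a: "a \<in> A" "c a = 1" by blast
  moreover have "c x \<noteq> 1"
  proof
    assume "c x = 1"
    moreover have "(x, a) \<in> Restr E S ^^ 1" using a adj \<open>x \<in> S\<close> \<open>A \<subseteq> S\<close> by auto
    ultimately show False
      using packing_coloring_dist[OF c, of x a 1] a \<open>x \<in> S\<close> \<open>A \<subseteq> S\<close> \<open>x \<notin> A\<close> by auto
  qed
  ultimately show thesis using that by blast
qed

text \<open>
  For \<open>q \<ge> 1\<close>, the infinite \<open>q\<close>-ary tree with its vertices numbered level by level, as in an array-based heap:
  the root is 0 and the parent of \<open>j > 0\<close> is \<open>(j - 1) div q\<close>. The vertices up to \<open>q + q * q\<close> are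
  those of depth at most two.
\<close>

definition kary_tree :: "nat \<Rightarrow> nat rel" where
  "kary_tree q = {(i, j). (0 < j \<and> i = (j - 1) div q) \<or> (0 < i \<and> j = (i - 1) div q)}"

lemma parent_less: "0 < j \<Longrightarrow> (j - 1) div q < (j::nat)"
  by (rule le_less_trans[OF div_le_dividend]) simp

interpretation kary: heap_ordered_forest "kary_tree q" for q
proof
  show "sym (kary_tree q)" by (auto simp: kary_tree_def sym_def)
  show "irrefl (kary_tree q)"
  proof (rule irreflI, rule notI)
    fix i assume "(i, i) \<in> kary_tree q"
    then have "0 < i" "i = (i - 1) div q" by (auto simp: kary_tree_def)
    with parent_less[of i q] show False by linarith
  qed
  fix u v w assume "(u, v) \<in> kary_tree q" "(w, v) \<in> kary_tree q" "u < v" "w < v"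
  then show "u = w"
    using parent_less[of u q] parent_less[of w q] by (auto simp: kary_tree_def)
qed

lemma kary_tree_child: "j \<in> {q * i + 1..q * i + q} \<Longrightarrow> (i, j) \<in> kary_tree q"
proof -
  assume j: "j \<in> {q * i + 1..q * i + q}"
  then have "(j - 1) div q = i"
    by (intro div_nat_eqI) (auto simp: algebra_simps)
  with j show ?thesis by (auto simp: kary_tree_def)
qed

text \<open>
  The root and each of its children, that is, all vertices up to \<open>q\<close>, have \<open>q\<close> children in the
  tree, so each has a child of color 1 and not color 1 itself. But a child of the root is among
  these vertices.
\<close>

lemma kary_tree_depth_2_not_colorable:
  assumes "1 \<le> q"
  shows "\<not> packing_coloring (kary_tree q) {..q + q * q} q c"
proof
  assume c: "packing_coloring (kary_tree q) {..q + q * q} q c"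
  have child: "\<exists>a \<in> {q * i + 1..q * i + q}. c a = 1 \<and> c i \<noteq> 1" if "i \<le> q" for i
  proof -
    have "q * i \<le> q * q" using that by simp
    then have sub: "{q * i + 1..q * i + q} \<subseteq> {..q + q * q}" by auto
    have "i \<le> q * i" using assms by simp
    then have notin: "i \<notin> {q * i + 1..q * i + q}" unfolding atLeastAtMost_iff by linarith
    have mem: "i \<in> {..q + q * q}" using that by simp
    obtain a where "a \<in> {q * i + 1..q * i + q}" "c a = 1" "c i \<noteq> 1"
      by (rule neighbor_with_color_1[OF c kary.sym assms mem sub notin kary_tree_child]) auto
    then show ?thesis by blast
  qed
  from child[of 0] obtain a where "a \<le> q" "c a = 1" by auto
  with child[of a] show False by auto
qed

section \<open>Critical trees\<close>

theorem proposition5p1: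
  fixes k :: nat
  assumes "2 \<le> k"
  shows "\<exists>G :: nat pair_pre_digraph.
           undirected_tree (with_proj G) \<and> packing_critical k (with_proj G)"
proof -
  define q where "q = k - 1"
  have q: "1 \<le> q" "k = Suc q" using assms by (auto simp: q_def)
  let ?E = "kary_tree q"
  let ?P = "\<lambda>S. finite S \<and> (\<nexists>c. packing_coloring ?E S q c)"
  have "?P {..q + q * q}" using kary_tree_depth_2_not_colorable[OF q(1)] by auto
  from ex_has_least_nat[where P = ?P and m = card, OF this]
  obtain S where "?P S \<and> (\<forall>T. ?P T \<longrightarrow> card S \<le> card T)" by (rule exE)
  then have S: "?P S" and min: "\<forall>T. ?P T \<longrightarrow> card S \<le> card T" by blast+
  have smaller: "\<exists>c. packing_coloring ?E T q c" if "T \<subset> S" for T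
  proof -
    have "finite T" "\<not> card S \<le> card T"
      unfolding not_le using that S by (auto intro: psubset_card_mono finite_subset)
    with min show ?thesis by auto
  qed
  have "S \<noteq> {}" using S by (auto simp: packing_coloring_def)
  have conn: "connected (with_proj (induced ?E S))"
  proof (rule connected_if_no_proper_component[OF kary.sym \<open>S \<noteq> {}\<close>], rule ccontr)
    fix C assume C: "C \<subseteq> S" "C \<noteq> {}" "C \<noteq> S"
      and closed: "\<And>a b. (a, b) \<in> Restr ?E S \<Longrightarrow> a \<in> C \<longleftrightarrow> b \<in> C"
    obtain c d where "packing_coloring ?E C q c" "packing_coloring ?E (S - C) q d"
      using smaller[of C] smaller[of "S - C"] C by auto
    from packing_coloring_glue[OF closed C(1) this] S show False by blast
  qed
  have tree: "undirected_tree (with_proj (induced ?E S))"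
    unfolding undirected_tree_def
    using kary.graph_induced[of S] S conn kary.no_long_cycle[of q S] by force
  have "Max S \<in> S" using S \<open>S \<noteq> {}\<close> by auto
  then obtain c where "packing_coloring ?E (S - {Max S}) q c"
    using smaller[of "S - {Max S}"] by blast
  then have "packing_coloring ?E S k (c(Max S := Suc q))"
    unfolding q(2)
    using S kary.Max_is_leaf kary.irrefl[of q]
    by (intro packing_coloring_add_leaf) (auto simp: irrefl_def)
  then have "packing_colorable (with_proj (induced ?E S)) k"
    by (auto simp: packing_colorable_induced_iff)
  moreover have "k \<le> j" if "packing_colorable (with_proj (induced ?E S)) j" for j
    using that S packing_coloring_mono[of ?E S j _ q] q(2)
    by (force simp: packing_colorable_induced_iff)
  ultimately have "packing_chromatic_number (with_proj (induced ?E S)) = k"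
    unfolding packing_chromatic_number_def by (rule Least_equality)
  moreover have "packing_chromatic_number
      (pre_digraph.del_vert (with_proj (induced ?E S)) x) < k" if "x \<in> S" for x
  proof -
    have "packing_colorable (with_proj (induced ?E (S - {x}))) q"
      using smaller[of "S - {x}"] that by (auto simp: packing_colorable_induced_iff)
    then have "packing_chromatic_number (with_proj (induced ?E (S - {x}))) \<le> q"
      unfolding packing_chromatic_number_def by (rule Least_le)
    then show ?thesis by (simp add: del_vert_induced q(2))
  qed
  ultimately have "packing_critical k (with_proj (induced ?E S))"
    by (simp add: packing_critical_def)
  with tree show ?thesis by blast
qed

end
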